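(* Let $C$ be a $2$-torsion free commutative ring with unity, let $n\geq 2$, and let $\mathcal{M}_n(C)$ be the $C$-algebra of $n\times n$ matrices over $C$. Let $f,g:\mathcal{M}_n(C)\to\mathcal{M}_n(C)$ be $C$-linear maps. Then $f$ is a Jordan left $\{g,g\}$-derivation if and only if there exist $n^2$ elements $g_{kj}^{(kk)}\in C$ ($1\leq k,j\leq n$) such that for every $A=\sum_{i=1}^{n}\sum_{j=1}^{n}a_{ij}e_{ij}\in\mathcal{M}_n(C)$ (with $a_{ij}\in C$), $$g(A)=\sum_{j=1}^{n}\sum_{i=1}^{n}\Big(\sum_{k=1}^{n}a_{ik}g_{kj}^{(kk)}\Big)e_{ij},\qquad f(A)=2g(A).$$ Moreover, if $f$ is a Jordan left $\{g,g\}$-derivation of $\mathcal{M}_n(C)$, then $f$ and $g$ are right centralizers.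
   Context: A ring $R$ is $2$-torsion free if $2a=0$ with $a\in R$ implies $a=0$. For an algebra $A$ over $C$ and $C$-linear maps $f,g,h:A\to A$, $f$ is a Jordan left $\{g,h\}$-derivation if $f(ab+ba)=2\big(a\,g(b)+b\,h(a)\big)$ for all $a,b\in A$; a Jordan left $\{g,g\}$-derivation is the case $h=g$. A linear map $\varphi:A\to A$ is a right centralizer if $\varphi(ab)=a\varphi(b)$ for all $a,b\in A$. $e_{ij}$ denotes the matrix whose $(i,j)$ entry is $1$ and whose other entries are $0$. The superscript in $g_{kj}^{(kk)}$ is just part of the name of the element. *)

theory Defs
  imports "HOL-Analysis.Finite_Cartesian_Product"
begin

text \<open>
  The algebra of \<open>n \<times> n\<close> matrices over \<open>C\<close> is the type \<open>'c ^ 'n ^ 'n\<close> with the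
  product \<open>**\<close>; the library's \<open>*\<close> and numerals on this type are entrywise and are
  not used.
\<close>

definition mscale :: "'c::comm_ring_1 \<Rightarrow> 'c ^ 'n ^ 'n \<Rightarrow> 'c ^ 'n ^ 'n"
  where "mscale c A = (\<chi> i j. c * A $ i $ j)"

definition matrix_unit :: "'n \<Rightarrow> 'n \<Rightarrow> 'c::comm_ring_1 ^ 'n ^ 'n"
  where "matrix_unit i j = (\<chi> r s. if r = i \<and> s = j then 1 else 0)"

lemma module_mscale: "module (mscale :: 'c::comm_ring_1 \<Rightarrow> 'c ^ 'n ^ 'n \<Rightarrow> 'c ^ 'n ^ 'n)"
  by unfold_locales (simp_all add: mscale_def vec_eq_iff algebra_simps)

text \<open>
  The next two notions are for an algebra given by its scalar multiplication
  \<open>smul\<close> and its product \<open>mul\<close>. Linearity of \<open>f\<close>, \<open>g\<close>, \<open>h\<close> is not part of the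
  first one and has to be assumed separately.
\<close>

definition jordan_left_derivation ::
  "('c::comm_ring_1 \<Rightarrow> 'a::ab_group_add \<Rightarrow> 'a) \<Rightarrow> ('a \<Rightarrow> 'a \<Rightarrow> 'a) \<Rightarrow>
    ('a \<Rightarrow> 'a) \<Rightarrow> ('a \<Rightarrow> 'a) \<Rightarrow> ('a \<Rightarrow> 'a) \<Rightarrow> bool"
  where "jordan_left_derivation smul mul g h f \<longleftrightarrow>
    (\<forall>a b. f (mul a b + mul b a) = smul 2 (mul a (g b) + mul b (h a)))"

definition right_centralizer ::
  "('c::comm_ring_1 \<Rightarrow> 'a::ab_group_add \<Rightarrow> 'a) \<Rightarrow> ('a \<Rightarrow> 'a \<Rightarrow> 'a) \<Rightarrow> ('a \<Rightarrow> 'a) \<Rightarrow> bool"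
  where "right_centralizer smul mul \<phi> \<longleftrightarrow>
    module_hom smul smul \<phi> \<and> (\<forall>a b. \<phi> (mul a b) = mul a (\<phi> b))"

end

theory Submission
  imports Defs
begin

text \<open>
  Putting \<open>a = 1\<close> in the defining identity and cancelling 2 gives \<open>f b = g b + b ** g 1\<close>, while
  \<open>a = b\<close> gives \<open>f (a ** a) = 2 a ** g a\<close>. So \<open>h b = g b - b ** g 1\<close> satisfies
  \<open>h (a ** a) = 2 a ** h a\<close>. For an idempotent \<open>e\<close> this reads \<open>h e = 2 e ** h e\<close>; multiplying by
  \<open>e\<close> gives \<open>e ** h e = 0\<close>, hence \<open>h e = 0\<close>. The matrix units \<open>e_ii\<close> and
  \<open>e_ij = (e_ii + e_ij) - e_ii\<close> are differences of idempotents, so \<open>h = 0\<close>: the map \<open>g\<close> is right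
  multiplication by \<open>g 1\<close>, whose entries are the required elements.
\<close>

text \<open>Each entry of the double sum picks out one coefficient. This passes between expansions
  in matrix units and plain matrices, and reduces a linear map to its values on matrix
  units.\<close>

lemma sum_mscale_matrix_unit:
  fixes a :: "'n::finite \<Rightarrow> 'n \<Rightarrow> 'c::comm_ring_1"
  shows "(\<Sum>i\<in>UNIV. \<Sum>j\<in>UNIV. mscale (a i j) (matrix_unit i j)) = (\<chi> i j. a i j)"
proof -
  have "(\<Sum>i\<in>UNIV. \<Sum>j\<in>UNIV. a i j * (if r = i \<and> s = j then 1 else 0)) = a r s" for r s
  proof -
    have "(\<Sum>j\<in>UNIV. a i j * (if r = i \<and> s = j then 1 else 0)) = (if i = r then a i s else 0)" for i
      by (cases "i = r") (simp_all add: if_distrib cong: if_cong)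
    then show ?thesis by simp
  qed
  then show ?thesis
    by (simp add: vec_eq_iff mscale_def matrix_unit_def)
qed

lemma matrix_add_rdistrib: "(A + B) ** C = A ** C + B ** C"
  for A B :: "'a::semiring_1 ^ 'n ^ 'm"
  by (simp add: vec_eq_iff matrix_matrix_mult_def distrib_right sum.distrib)

lemma matrix_diff_ldistrib: "A ** (B - C) = A ** B - A ** C"
  for B C :: "'a::ring_1 ^ 'p ^ 'n"
  by (simp add: vec_eq_iff matrix_matrix_mult_def right_diff_distrib sum_subtractf)

lemma mscale_matrix_mul_left: "mscale c A ** B = mscale c (A ** B)"
  by (simp add: vec_eq_iff mscale_def matrix_matrix_mult_def sum_distrib_left mult.assoc)

lemma mscale_matrix_mul_right: "A ** mscale c B = mscale c (A ** B)"
  by (simp add: vec_eq_iff mscale_def matrix_matrix_mult_def sum_distrib_left mult.left_commute)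

lemma mscale_two: "mscale 2 A = A + A"
  by (simp add: vec_eq_iff mscale_def)

text \<open>Scaling acts entrywise, so torsion-freeness of the scalars carries over to
  matrices.\<close>

lemma mscale_two_cancel:
  fixes A B :: "'c::comm_ring_1 ^ 'n::finite ^ 'n"
  assumes "\<forall>c::'c. 2 * c = 0 \<longrightarrow> c = 0" and "mscale 2 A = mscale 2 B"
  shows "A = B"
proof -
  have "2 * (A $ i $ j - B $ i $ j) = 0" for i j
    using assms(2) by (simp add: vec_eq_iff mscale_def right_diff_distrib)
  then have "A $ i $ j - B $ i $ j = 0" for i j
    using assms(1) by blast
  then show ?thesis
    by (simp add: vec_eq_iff)
qed

lemma matrix_unit_mult:
  "(matrix_unit i j :: 'c::comm_ring_1 ^ 'n::finite ^ 'n) ** matrix_unit k l =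
    (if j = k then matrix_unit i l else 0)"
proof -
  have "(\<Sum>t\<in>UNIV. (if r = i \<and> t = j then 1 else 0) * (if t = k \<and> s = l then 1 else 0)) =
      (if j = k \<and> r = i \<and> s = l then 1 else (0::'c))" for r s
  proof -
    \<comment> \<open>Only \<open>t = j\<close> can contribute, and there the second condition
      \<open>t = k\<close> becomes \<open>j = k\<close>, which no longer depends on
      \<open>t\<close>.\<close>
    have "(\<Sum>t\<in>UNIV. (if r = i \<and> t = j then 1 else 0) * (if t = k \<and> s = l then 1 else 0)) =
      (\<Sum>t\<in>UNIV. if t = j then (if j = k \<and> r = i \<and> s = l then 1 else (0::'c)) else 0)"
      by (rule sum.cong) auto
    then show ?thesis by simp
  qed
  then show ?thesis
    by (simp add: vec_eq_iff matrix_matrix_mult_def matrix_unit_def)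
qed

lemma right_mult_mscale_hom: "module_hom mscale mscale (\<lambda>A. A ** B)"
  by (intro module_hom.intro module_mscale module_hom_axioms.intro)
    (simp_all add: matrix_add_rdistrib mscale_matrix_mul_left)

lemma jordan_left_derivation_self_mult:
  assumes tf: "\<forall>c::'c::comm_ring_1. 2 * c = 0 \<longrightarrow> c = 0"
    and f: "module_hom mscale mscale f"
    and J: "jordan_left_derivation mscale (**) g g (f :: 'c ^ 'n::finite ^ 'n \<Rightarrow> _)"
  shows "f b = g b + b ** g (mat 1)" and "f (a ** a) = mscale 2 (a ** g a)"
proof -
  have J': "f (a ** b) + f (b ** a) = mscale 2 (a ** g b + b ** g a)" for a b
    using J by (simp add: jordan_left_derivation_def module_hom.add[OF f])
  have "mscale 2 (f b) = mscale 2 (g b + b ** g (mat 1))"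
    using J'[of "mat 1" b] by (simp only: matrix_mul_lid matrix_mul_rid mscale_two[of "f b"])
  then show "f b = g b + b ** g (mat 1)"
    by (rule mscale_two_cancel[OF tf])
  \<comment> \<open>With both arguments equal to \<open>a\<close>, each side of \<open>J'\<close> is
    a doubled term; the right side is doubled twice, so one factor 2 survives cancellation.\<close>
  have "mscale 2 (f (a ** a)) = mscale 2 (mscale 2 (a ** g a))"
    using J'[of a a] by (simp only: mscale_two[of "f (a ** a)"] mscale_two[of "a ** g a"])
  then show "f (a ** a) = mscale 2 (a ** g a)"
    by (rule mscale_two_cancel[OF tf])
qed

lemma jordan_left_derivation_idempotent_eq_0:
  fixes h :: "'c::comm_ring_1 ^ 'n::finite ^ 'n \<Rightarrow> 'c ^ 'n ^ 'n"
  assumes h: "\<And>a. h (a ** a) = mscale 2 (a ** h a)" and e: "e ** e = e"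
  shows "h e = 0"
proof -
  have he: "h e = e ** h e + e ** h e"
    using h[of e] unfolding e mscale_two .
  have "e ** h e = e ** (e ** h e + e ** h e)"
    by (rule arg_cong[OF he])
  also have "\<dots> = e ** h e + e ** h e"
    unfolding matrix_add_ldistrib matrix_mul_assoc e ..
  finally have "e ** h e = 0"
    by (simp only: add_cancel_right_left)
  with he show ?thesis
    by (simp only: add_0_left)
qed

lemma mscale_hom_eq_0_if_idempotents:
  fixes h :: "'c::comm_ring_1 ^ 'n::finite ^ 'n \<Rightarrow> 'c ^ 'n ^ 'n"
  assumes h: "module_hom mscale mscale h"
    and idem: "\<And>e. e ** e = e \<Longrightarrow> h e = 0"
  shows "h A = 0"
proof -
  have diag: "h (matrix_unit i i) = 0" for i
    by (rule idem) (simp add: matrix_unit_mult)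
  have "h (matrix_unit i j) = 0" for i j
  proof (cases "i = j")
    case False
    \<comment> \<open>For \<open>i \<noteq> j\<close> the products \<open>e_ij e_ii\<close> and
      \<open>e_ij e_ij\<close> vanish, so the square of \<open>e_ii + e_ij\<close> is
      \<open>e_ii e_ii + e_ii e_ij\<close>, the sum itself.\<close>
    then have "h (matrix_unit i i + matrix_unit i j) = 0"
      by (intro idem) (simp add: matrix_add_ldistrib matrix_add_rdistrib matrix_unit_mult)
    then show ?thesis
      by (simp add: module_hom.add[OF h] diag)
  qed (simp add: diag)
  then have "h (\<Sum>i\<in>UNIV. \<Sum>j\<in>UNIV. mscale (A $ i $ j) (matrix_unit i j)) = 0"
    by (simp add: module_hom.sum[OF h] module_hom.scale[OF h] module.scale_zero_right[OF module_mscale])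
  then show ?thesis
    by (simp add: sum_mscale_matrix_unit)
qed

lemma jordan_left_derivation_imp_right_mult:
  assumes tf: "\<forall>c::'c::comm_ring_1. 2 * c = 0 \<longrightarrow> c = 0"
    and f: "module_hom mscale mscale f" and g: "module_hom mscale mscale g"
    and J: "jordan_left_derivation mscale (**) g g (f :: 'c ^ 'n::finite ^ 'n \<Rightarrow> _)"
  shows "g A = A ** g (mat 1)" and "f A = mscale 2 (g A)"
proof -
  note fg = jordan_left_derivation_self_mult[OF tf f J]
  define h where "h A = g A - A ** g (mat 1)" for A
  have h: "module_hom mscale mscale h"
    unfolding h_def by (rule module_pair.module_hom_sub[OF _ g right_mult_mscale_hom])
      (simp add: module_pair_def module_mscale)
  have "h (a ** a) = mscale 2 (a ** h a)" for a
  proof -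
    \<comment> \<open>Since \<open>f b\<close> exceeds \<open>g b\<close> by
      \<open>b ** g (mat 1)\<close> and \<open>h b\<close> falls short of \<open>g b\<close> by the
      same term, \<open>f\<close> and \<open>h\<close> differ by twice that term.\<close>
    have "h (a ** a) = f (a ** a) - mscale 2 (a ** a ** g (mat 1))"
      unfolding h_def fg(1) mscale_two by simp
    also have "\<dots> = mscale 2 (a ** h a)"
      unfolding fg(2) h_def matrix_diff_ldistrib matrix_mul_assoc
        module.scale_right_diff_distrib[OF module_mscale] ..
    finally show ?thesis .
  qed
  then have "h e = 0" if "e ** e = e" for e
    using that by (rule jordan_left_derivation_idempotent_eq_0)
  then have "h A = 0"
    by (rule mscale_hom_eq_0_if_idempotents[OF h])
  then show gA: "g A = A ** g (mat 1)"
    by (simp add: h_def)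
  show "f A = mscale 2 (g A)"
    using fg(1)[of A] gA by (simp add: mscale_two)
qed

text \<open>By associativity and distributivity both sides of the identity equal
  \<open>2 (ab + ba) G\<close>.\<close>

lemma jordan_left_derivation_right_mult:
  assumes g: "\<And>A. g A = A ** G" and f: "\<And>A. f A = mscale 2 (g A)"
  shows "jordan_left_derivation mscale (**) g g (f :: 'c::comm_ring_1 ^ 'n::finite ^ 'n \<Rightarrow> _)"
  unfolding jordan_left_derivation_def f g by (simp add: matrix_add_rdistrib matrix_mul_assoc)

theorem theorem2p11:
  fixes f g :: "'c::comm_ring_1 ^ 'n::finite ^ 'n \<Rightarrow> 'c ^ 'n ^ 'n"
  assumes torsion_free: "\<And>c::'c. 2 * c = 0 \<Longrightarrow> c = 0"
    and n: "CARD('n) \<ge> 2"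
    and f: "module_hom mscale mscale f"
    and g: "module_hom mscale mscale g"
  shows "(jordan_left_derivation mscale (**) g g f \<longleftrightarrow>
      (\<exists>gkk :: 'n \<Rightarrow> 'n \<Rightarrow> 'c. \<forall>A (a :: 'n \<Rightarrow> 'n \<Rightarrow> 'c).
        A = (\<Sum>i\<in>UNIV. \<Sum>j\<in>UNIV. mscale (a i j) (matrix_unit i j)) \<longrightarrow>
        g A = (\<Sum>j\<in>UNIV. \<Sum>i\<in>UNIV.
                mscale (\<Sum>k\<in>UNIV. a i k * gkk k j) (matrix_unit i j)) \<and>
        f A = mscale 2 (g A)))
    \<and> (jordan_left_derivation mscale (**) g g f \<longrightarrow>
        right_centralizer mscale (**) f \<and> right_centralizer mscale (**) g)"
    (is "(?J \<longleftrightarrow> (\<exists>gkk. ?P gkk)) \<and> (?J \<longrightarrow> ?R)")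
proof -
  have P_iff: "?P gkk \<longleftrightarrow> (\<forall>A. g A = A ** (\<chi> k j. gkk k j) \<and> f A = mscale 2 (g A))" for gkk
  proof -
    \<comment> \<open>The inner sum over \<open>k\<close> is the \<open>(i, j)\<close> entry of a
      matrix product, so the coordinate formula for \<open>g\<close> is right multiplication by the
      matrix of the \<open>gkk k j\<close>.\<close>
    have expand: "(\<Sum>j\<in>UNIV. \<Sum>i\<in>UNIV. mscale (\<Sum>k\<in>UNIV. a i k * gkk k j) (matrix_unit i j)) =
        (\<chi> i j. a i j) ** (\<chi> k j. gkk k j)" for a
      by (subst sum.swap) (simp add: sum_mscale_matrix_unit matrix_matrix_mult_def)
    show ?thesis
      unfolding expand sum_mscale_matrix_unit
    proof (intro iffI allI impI)
      fix A
      assume "\<forall>A a. A = (\<chi> i j. a i j) \<longrightarrow>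
        g A = (\<chi> i j. a i j) ** (\<chi> k j. gkk k j) \<and> f A = mscale 2 (g A)"
      \<comment> \<open>The coefficients of \<open>A\<close> in its expansion are its own
        entries.\<close>
      from this[rule_format, of A "\<lambda>i j. A $ i $ j"]
      show "g A = A ** (\<chi> k j. gkk k j) \<and> f A = mscale 2 (g A)"
        by (simp only: vec_lambda_eta)
    qed (simp only:)
  qed
  have mult: "g A = A ** g (mat 1)" "f A = mscale 2 (g A)" if ?J for A
    using jordan_left_derivation_imp_right_mult[OF _ f g that] torsion_free by blast+
  have "?J \<longleftrightarrow> (\<exists>gkk. ?P gkk)"
  proof
    assume ?J
    then have "?P (\<lambda>k j. g (mat 1) $ k $ j)"
      unfolding P_iff vec_lambda_eta using mult by blast
    then show "\<exists>gkk. ?P gkk"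
      by (rule exI[of ?P])
  next
    assume "\<exists>gkk. ?P gkk"
    then obtain gkk where "\<forall>A. g A = A ** (\<chi> k j. gkk k j) \<and> f A = mscale 2 (g A)"
      unfolding P_iff ..
    then show ?J
      by (intro jordan_left_derivation_right_mult[where G = "\<chi> k j. gkk k j"]) blast+
  qed
  moreover have "?J \<longrightarrow> ?R"
  proof
    assume that: ?J
    have gm: "g (a ** b) = a ** g b" for a b
      unfolding mult(1)[OF that, of "a ** b"] mult(1)[OF that, of b] by (simp only: matrix_mul_assoc)
    then have "f (a ** b) = a ** f b" for a b
      by (simp add: mult(2)[OF that] mscale_matrix_mul_right)
    with gm show ?R
      by (simp add: right_centralizer_def f g)
  qed
  ultimately show ?thesis ..
qed

end
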